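(* Let $k\geq 4$ and $h\geq 2$ be integers and let $G$ be an ordered additive abelian group with order $\preceq$. Suppose $a_1,\dots,a_{k-3}\in G$ satisfy $0\prec a_1\prec a_2\prec\cdots\prec a_{k-3}$. Let $b,c\in G$ with $0\prec b$ and $0\prec c$, and suppose $c\neq db$ for every positive integer $d$. If $$A=\{0,a_1,a_2,\dots,a_{k-3},\,a_{k-3}+b,\,a_{k-3}+b+c\},$$ then $hA$ has at least $h-1$ nontrivial elements.
   Context: An ordered additive abelian group is an additive abelian group $G$ with a total order $\preceq$ such that for all $x,y,z\in G$, $x\prec y$ implies $x+z\prec y+z$ (here $\prec$ means $\preceq$ and $\neq$). For an integer $h\geq 2$ and $A\subseteq G$, the $h$-fold sumset is $hA=\{x_1+\cdots+x_h : x_1,\dots,x_h\in A\}$. For a positive integer $n$, $ng$ denotes the sum of $n$ copies of $g$. If $A=\{x_1,\dots,x_m\}$ with $x_1\prec x_2\prec\cdots\prec x_m$, an element of $hA$ is called trivial (with respect to $A$) if it equals $(h-i)x_j+ix_{j+1}$ for some integers $0\leq i\leq h$ and $1\leq j\leq m-1$; otherwise it is called nontrivial. (There are exactly $hm-h+1$ trivial elements.) *)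

theory Defs
  imports "HOL-Library.FuncSet"
begin

definition nmult :: "nat \<Rightarrow> 'a::comm_monoid_add \<Rightarrow> 'a" where
  "nmult n g = (\<Sum>i<n. g)"

definition hfold_sumset :: "nat \<Rightarrow> 'a::comm_monoid_add set \<Rightarrow> 'a set" where
  "hfold_sumset h A = {\<Sum>i<h. x i | x. x \<in> {..<h} \<rightarrow> A}"

text \<open>
  The increasing enumeration of the finite set \<open>A\<close> is \<open>sorted_list_of_set A\<close>, indexed from
  0, so the element called \<open>x\<^sub>j\<close> in the usual 1-based numbering is entry \<open>j - 1\<close> here.
  These definitions are meaningful only for finite \<open>A\<close>.
\<close>

definition trivial_element :: "nat \<Rightarrow> 'a::linordered_ab_group_add set \<Rightarrow> 'a \<Rightarrow> bool" where
  "trivial_element h A s \<longleftrightarrow>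
     (\<exists>i j. i \<le> h \<and> j + 1 < card A \<and>
        s = nmult (h - i) (sorted_list_of_set A ! j) + nmult i (sorted_list_of_set A ! (j + 1)))"

definition nontrivial_elements :: "nat \<Rightarrow> 'a::linordered_ab_group_add set \<Rightarrow> 'a set" where
  "nontrivial_elements h A = {s \<in> hfold_sumset h A. \<not> trivial_element h A s}"

end

theory Submission
  imports Defs
begin

text \<open>
  Put \<open>q = a\<^sub>k\<^sub>-\<^sub>3\<close>. The \<open>h - 1\<close> elements \<open>h q + j b + c\<close> with \<open>1 \<le> j < h\<close> are nontrivial.
  Indeed, a trivial element built from two neighbours up to \<open>q\<close> is at most \<open>h q\<close>; one built
  from \<open>q, q + b\<close> is \<open>h q + i b\<close>, and one built from \<open>q + b, q + b + c\<close> is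
  \<open>h q + h b + i c\<close>. The last exceeds \<open>h q + j b + c\<close> unless \<open>i = 0\<close>, so any coincidence
  makes \<open>c\<close> a positive multiple of \<open>b\<close>.
\<close>

lemma nmult_0 [simp]: "nmult 0 g = 0"
  by (simp add: nmult_def)

lemma nmult_Suc [simp]: "nmult (Suc n) g = nmult n g + g"
  by (simp add: nmult_def)

lemma nmult_add_left: "nmult (m + n) g = nmult m g + nmult n g"
  by (induction n) (simp_all add: add.assoc)

lemma nmult_add_right: "nmult n (g + h) = nmult n g + nmult n h"
  by (simp add: nmult_def sum.distrib)

lemma nmult_mono: "g \<le> g' \<Longrightarrow> nmult n g \<le> nmult n g'"
  for g g' :: "'a::ordered_comm_monoid_add"
  by (simp add: nmult_def sum_mono)

lemma nmult_nonneg: "0 \<le> g \<Longrightarrow> 0 \<le> nmult n g"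
  for g :: "'a::ordered_comm_monoid_add"
  by (simp add: nmult_def sum_nonneg)

lemma nmult_pos: "0 < g \<Longrightarrow> 0 < n \<Longrightarrow> 0 < nmult n g"
  for g :: "'a::linordered_ab_group_add"
  by (cases n) (simp_all add: add_nonneg_pos nmult_nonneg)

lemma nmult_less_left: "nmult m g < nmult n g" if "0 < g" "m < n"
  for g :: "'a::linordered_ab_group_add"
proof -
  have "nmult n g = nmult m g + nmult (n - m) g"
    using that by (simp flip: nmult_add_left)
  with that show ?thesis by (simp add: nmult_pos)
qed

lemma hfold_sumset_0 [simp]: "hfold_sumset 0 A = {0}"
  by (auto simp: hfold_sumset_def)

text \<open>Splitting off the last summand, or appending one by the update \<open>x(h := y)\<close>,
  gives a recursion on \<open>h\<close> that supports the later inductions.\<close>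

lemma hfold_sumset_Suc: "hfold_sumset (Suc h) A = (\<lambda>(s, x). s + x) ` (hfold_sumset h A \<times> A)"
proof (intro equalityI subsetI)
  fix t assume "t \<in> hfold_sumset (Suc h) A"
  then obtain x where x: "x \<in> {..<Suc h} \<rightarrow> A" "t = (\<Sum>i<Suc h. x i)"
    by (auto simp: hfold_sumset_def)
  then have "x \<in> {..<h} \<rightarrow> A" "x h \<in> A"
    by auto
  then have "(\<Sum>i<h. x i) \<in> hfold_sumset h A" "x h \<in> A"
    unfolding hfold_sumset_def by blast+
  with x(2) show "t \<in> (\<lambda>(s, x). s + x) ` (hfold_sumset h A \<times> A)"
    by force
next
  fix t assume "t \<in> (\<lambda>(s, x). s + x) ` (hfold_sumset h A \<times> A)"
  then obtain x y where x: "x \<in> {..<h} \<rightarrow> A" "y \<in> A" "t = (\<Sum>i<h. x i) + y"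
    by (auto simp: hfold_sumset_def)
  then have "x(h := y) \<in> {..<Suc h} \<rightarrow> A" "t = (\<Sum>i<Suc h. (x(h := y)) i)"
    by (auto simp: less_Suc_eq)
  then show "t \<in> hfold_sumset (Suc h) A"
    unfolding hfold_sumset_def by blast
qed

lemma finite_hfold_sumset: "finite A \<Longrightarrow> finite (hfold_sumset h A)"
  by (induction h) (simp_all add: hfold_sumset_Suc)

lemma hfold_sumset_add_nmult:
  assumes "s \<in> hfold_sumset h A" "x \<in> A"
  shows "s + nmult n x \<in> hfold_sumset (h + n) A"
proof (induction n)
  case (Suc n)
  then have "(s + nmult n x) + x \<in> hfold_sumset (Suc (h + n)) A"
    using \<open>x \<in> A\<close> by (force simp: hfold_sumset_Suc)
  then show ?case by (simp add: add.assoc)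
qed (use assms in simp)

text \<open>Consecutive entries of a strictly sorted list leave no element of \<open>A\<close>
  strictly between them. This replaces list indices by an order condition.\<close>

lemma trivial_element_neighbours:
  assumes "trivial_element h A s" "finite A"
  obtains i x y where "i \<le> h" "x \<in> A" "y \<in> A" "x < y" "\<And>z. z \<in> A \<Longrightarrow> z \<le> x \<or> y \<le> z"
    "s = nmult (h - i) x + nmult i y"
proof -
  define xs where "xs = sorted_list_of_set A"
  have xs: "sorted_wrt (<) xs" "set xs = A" "length xs = card A"
    using assms(2) by (simp_all add: xs_def)
  obtain i j where ij: "i \<le> h" "j + 1 < card A"
      "s = nmult (h - i) (xs ! j) + nmult i (xs ! (j + 1))"
    using assms(1) by (auto simp: trivial_element_def xs_def)
  have mono: "xs ! l \<le> xs ! m" if "l \<le> m" "m < card A" for l m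
    using that xs by (metis le_neq_implies_less order.refl less_imp_le sorted_wrt_nth_less)
  show thesis
  proof (rule that[OF ij(1) _ _ _ _ ij(3)])
    show "xs ! j \<in> A" "xs ! (j + 1) \<in> A"
      using xs ij(2) nth_mem[of j xs] nth_mem[of "j + 1" xs] by simp_all
    show "xs ! j < xs ! (j + 1)"
      using xs ij(2) by (simp add: sorted_wrt_nth_less)
    fix z assume "z \<in> A"
    then obtain l where "l < card A" "z = xs ! l"
      using xs by (metis in_set_conv_nth)
    then show "z \<le> xs ! j \<or> xs ! (j + 1) \<le> z"
      using mono[of l j] mono[of "j + 1" l] ij(2) by (cases "l \<le> j") simp_all
  qed
qed

text \<open>The larger neighbour \<open>y\<close> decides the case. Below \<open>q\<close> a bound
  suffices; above it, the gap condition determines \<open>x\<close> exactly.\<close>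

lemma trivial_element_cases:
  fixes q b c :: "'a::linordered_ab_group_add"
  assumes "trivial_element h A t" "finite A" "0 < b" "0 < c"
    and in_A: "q \<in> A" "q + b \<in> A"
    and A: "\<And>x. x \<in> A \<Longrightarrow> x \<le> q \<or> x = q + b \<or> x = q + b + c"
  obtains "t \<le> nmult h q"
  | i where "t = nmult h q + nmult i b"
  | i where "t = nmult h q + nmult h b + nmult i c"
proof -
  obtain i x y where i: "i \<le> h" and xy: "x \<in> A" "y \<in> A" "x < y"
      and gap: "\<And>z. z \<in> A \<Longrightarrow> z \<le> x \<or> y \<le> z"
      and t: "t = nmult (h - i) x + nmult i y"
    using trivial_element_neighbours[OF assms(1,2)] by metis
  have split: "nmult h z = nmult (h - i) z + nmult i z" for z :: 'a
    using i by (simp flip: nmult_add_left)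
  consider "y \<le> q" | "y = q + b" | "y = q + b + c" using A xy(2) by blast
  then show thesis
  proof cases
    case 1
    with xy have "t \<le> nmult h q"
      unfolding t split by (intro add_mono nmult_mono) simp_all
    then show thesis by (rule that(1))
  next
    case 2
    have "q < y" "y < q + b + c" using 2 assms by simp_all
    \<comment> \<open>The gap condition at \<open>q\<close> gives \<open>q \<le> x\<close>, while
      \<open>x < q + b\<close> leaves only \<open>x \<le> q\<close>.\<close>
    then have "x = q" using A[OF xy(1)] gap[OF in_A(1)] xy(3) 2 by auto
    with 2 have "t = nmult h q + nmult i b"
      by (simp add: t split[of q] nmult_add_right ac_simps)
    then show thesis by (rule that(2))
  next
    case 3
    have "q < q + b" "q + b < y" using 3 assms by simp_all
    then have "q + b \<le> x" using gap[OF in_A(2)] by (simp add: not_le[symmetric])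
    with \<open>q < q + b\<close> have "\<not> x \<le> q" by (metis order.strict_trans2 not_less)
    then have "x = q + b" using A[OF xy(1)] xy(3) 3 by auto
    with 3 have "t = nmult h q + nmult h b + nmult i c"
      by (simp add: t split[of q] split[of b] nmult_add_right ac_simps)
    then show thesis by (rule that(3))
  qed
qed

text \<open>Only the three largest elements \<open>q\<close>, \<open>q + b\<close>,
  \<open>q + b + c\<close> are named, since they alone supply the summands of the nontrivial
  sums.\<close>

lemma card_nontrivial_elements_ge:
  fixes q b c :: "'a::linordered_ab_group_add"
  assumes "finite A" "0 < b" "0 < c"
    and not_mult: "\<And>d. d > 0 \<Longrightarrow> c \<noteq> nmult d b"
    and in_A: "q \<in> A" "q + b \<in> A" "q + b + c \<in> A"
    and A: "\<And>x. x \<in> A \<Longrightarrow> x \<le> q \<or> x = q + b \<or> x = q + b + c"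
  shows "h - 1 \<le> card (nontrivial_elements h A)"
proof -
  define f where "f j = nmult h q + nmult j b + c" for j
  have sum: "f j \<in> hfold_sumset h A" if j: "j \<in> {1..<h}" for j
  proof -
    \<comment> \<open>The single summand \<open>q + b + c\<close> already contributes one
      \<open>b\<close>, so \<open>j - 1\<close> copies of \<open>q + b\<close> and
      \<open>h - j\<close> copies of \<open>q\<close> complete the sum.\<close>
    obtain m where m: "j = Suc m" using j by (cases j) auto
    have "0 + nmult (h - j) q + nmult m (q + b) + nmult 1 (q + b + c)
        \<in> hfold_sumset (0 + (h - j) + m + 1) A"
      by (intro hfold_sumset_add_nmult in_A) simp
    also have "0 + (h - j) + m + 1 = h" using j m by simp
    also have "0 + nmult (h - j) q + nmult m (q + b) + nmult 1 (q + b + c)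
        = (nmult (h - j) q + nmult j q) + nmult j b + c"
      by (simp add: m nmult_add_right ac_simps)
    also have "nmult (h - j) q + nmult j q = nmult h q"
      using j by (simp flip: nmult_add_left)
    finally show ?thesis by (simp add: f_def)
  qed
  have nontriv: "\<not> trivial_element h A (f j)" if j: "j \<in> {1..<h}" for j
  proof
    \<comment> \<open>For \<open>i > j\<close>, cancellation makes \<open>c\<close> a positive
      multiple of \<open>b\<close>; for \<open>i \<le> j\<close>, the left side is larger because
      \<open>c > 0\<close>.\<close>
    have no: False if eq: "nmult j b + c = nmult i b" for i
    proof (cases "j < i")
      case True
      then have "nmult i b = nmult j b + nmult (i - j) b"
        by (simp flip: nmult_add_left)
      with eq have "c = nmult (i - j) b" by simp
      with not_mult[of "i - j"] True show False by simp
    next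
      case False
      then have "nmult i b \<le> nmult j b"
        using nmult_less_left[OF \<open>0 < b\<close>, of i j] by (cases "i = j") simp_all
      also have "\<dots> < nmult j b + c" using \<open>0 < c\<close> by simp
      finally show False using eq by simp
    qed
    assume "trivial_element h A (f j)"
    then consider "f j \<le> nmult h q" | i where "f j = nmult h q + nmult i b"
      | i where "f j = nmult h q + nmult h b + nmult i c"
      using trivial_element_cases[OF _ assms(1-3) in_A(1,2) A] by metis
    then show False
    proof cases
      case 1
      have "0 < nmult j b + c"
        using \<open>0 < b\<close> \<open>0 < c\<close> by (simp add: add_nonneg_pos nmult_nonneg)
      with 1 show False by (simp add: f_def add.assoc flip: not_less)
    next
      case (2 i)
      then show False using no[of i] by (simp add: f_def add.assoc)
    next
      case (3 i)
      then have eq: "nmult j b + c = nmult h b + nmult i c"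
        by (simp add: f_def add.assoc)
      show False
      \<comment> \<open>For \<open>i = 0\<close> this is the equation just excluded, with
        \<open>h\<close> copies of \<open>b\<close>. For \<open>i > 0\<close> the right side is
        strictly larger, since \<open>j < h\<close> and \<open>c \<le> nmult i c\<close>.\<close>
      proof (cases i)
        case 0
        with eq no[of h] show False by simp
      next
        case (Suc n)
        have "nmult j b < nmult h b"
          using j by (intro nmult_less_left \<open>0 < b\<close>) simp
        moreover have "c \<le> nmult i c"
          using \<open>0 < c\<close> by (simp add: Suc nmult_nonneg)
        ultimately show False
          using eq add_less_le_mono by fastforce
      qed
    qed
  qed
  \<comment> \<open>As \<open>b > 0\<close>, \<open>f\<close> is strictly increasing.\<close>
  have "inj_on f {1..<h}"
    using nmult_less_left[OF \<open>0 < b\<close>] by (intro linorder_inj_onI) (auto simp: f_def less_le)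
  then have "h - 1 = card (f ` {1..<h})" by (simp add: card_image)
  also have "\<dots> \<le> card (nontrivial_elements h A)"
    using sum nontriv \<open>finite A\<close>
    by (intro card_mono) (auto simp: nontrivial_elements_def finite_hfold_sumset)
  finally show ?thesis .
qed

theorem theorem3p3:
  fixes k h :: nat
    and a :: "nat \<Rightarrow> 'a::linordered_ab_group_add"
    and b c :: 'a
    and A :: "'a set"
  assumes "k \<ge> 4" and "h \<ge> 2"
    and "0 < a 1" and "strict_mono_on {1..k - 3} a"
    and "0 < b" and "0 < c"
    and "\<And>d::nat. d > 0 \<Longrightarrow> c \<noteq> nmult d b"
    and "A = {0} \<union> a ` {1..k - 3} \<union> {a (k - 3) + b, a (k - 3) + b + c}"
  shows "card (nontrivial_elements h A) \<ge> h - 1"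
proof (rule card_nontrivial_elements_ge[where q = "a (k - 3)" and b = b and c = c])
  have le: "a i \<le> a (k - 3)" if "i \<in> {1..k - 3}" for i
    using that assms(1) strict_mono_on_leD[OF assms(4), of i "k - 3"] by simp
  \<comment> \<open>From \<open>k \<ge> 4\<close>, index 1 lies in \<open>{1..k - 3}\<close>, so
    \<open>a (k - 3)\<close> also bounds the element 0.\<close>
  then have "0 \<le> a (k - 3)"
    using assms(1,3) le[of 1] order.trans[of 0 "a 1"] by simp
  with le show "x \<le> a (k - 3) \<or> x = a (k - 3) + b \<or> x = a (k - 3) + b + c" if "x \<in> A" for x
    using that assms(8) by auto
qed (use assms in auto)

end
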